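(* Let $b(n)$ be a variable-$r$ meta-Fibonacci sequence generated by $r(n)$. For all $n\ge 1$, we have $b(n)\le 2^{n-1}$.
   Context: Let $\mathbb{N}$ be the non-negative integers and $\mathbb{Z}^+$ the positive integers. Let $r:\mathbb{N}\to\mathbb{Z}^+$ satisfy $r(0)=1$ and $r(n)\le n$ for all $n\ge 1$. The variable-$r$ meta-Fibonacci sequence generated by $r(n)$ is the sequence $b:\mathbb{N}\to\mathbb{Z}^+$ defined by $b(0)=1$ and $b(n)=\sum_{k=1}^{r(n)} b(n-k)$ for $n\ge 1$. *)

theory Defs
  imports Main
begin

text \<open>Admissible generating functions; \<open>r\<close> takes values in the positive integers.\<close>

definition meta_fib_generator :: "(nat \<Rightarrow> nat) \<Rightarrow> bool" where
  "meta_fib_generator r \<longleftrightarrow> (\<forall>n. r n > 0) \<and> r 0 = 1 \<and> (\<forall>n\<ge>1. r n \<le> n)"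

text \<open>
  The recursion is total for arbitrary \<open>r\<close>. For a generator, every index \<open>k\<close> in the sum
  satisfies \<open>k \<le> r n \<le> n\<close>, so the subtraction \<open>n - k\<close> is never truncated.
\<close>

function meta_fib :: "(nat \<Rightarrow> nat) \<Rightarrow> nat \<Rightarrow> nat" where
  "meta_fib r n = (if n = 0 then 1 else (\<Sum>k = 1..r n. meta_fib r (n - k)))"
  by pat_completeness auto
termination
  by (relation "measure snd") auto

declare meta_fib.simps [simp del]

text \<open>The sequence generated by a generator takes values in the positive integers.\<close>

lemma meta_fib_pos:
  assumes "meta_fib_generator r"
  shows "meta_fib r n > 0"
proof (induction n rule: less_induct)
  case (less n)
  show ?case
  proof (cases "n = 0")
    case True
    then show ?thesis by (simp add: meta_fib.simps)
  next
    case False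
    have "1 \<le> r n"
      using assms by (simp add: meta_fib_generator_def Suc_le_eq)
    moreover have "meta_fib r (n - k) > 0" if "k \<in> {1..r n}" for k
      using that False by (intro less) auto
    ultimately have "(\<Sum>k = 1..r n. meta_fib r (n - k)) > 0"
      by (intro sum_pos) auto
    with False show ?thesis by (subst meta_fib.simps) simp
  qed
qed

end

theory Submission
  imports Defs
begin

text \<open>
  A term of the sequence adds up some of the terms preceding it, and all terms are
  non-negative, so it is at most the sum of \<^emph>\<open>all\<close> preceding terms
  (\<open>meta_fib_le_sum_lessThan\<close>). Appending a term therefore at most doubles the partial
  sum. The partial sum consisting of the term at \<open>0\<close> alone is \<open>1\<close>, so the sum of the
  first \<open>n \<ge> 1\<close> terms is at most \<open>2 ^ (n - 1)\<close> (\<open>sum_le_power2_if_le_prefix_sum\<close>), and this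
  sum again bounds the next term.
\<close>

text \<open>
  The bound \<open>r n \<le> n\<close> makes \<open>k \<mapsto> n - k\<close> injective on the summation range, so no earlier
  term is counted twice; truncated subtraction would repeat the term at \<open>0\<close> otherwise.
\<close>

lemma meta_fib_le_sum_lessThan:
  assumes "n \<ge> 1" and "r n \<le> n"
  shows "meta_fib r n \<le> (\<Sum>i<n. meta_fib r i)"
proof -
  have inj: "inj_on (\<lambda>k. n - k) {1..r n}"
    using assms(2) by (intro inj_onI) auto
  have "meta_fib r n = (\<Sum>k = 1..r n. meta_fib r (n - k))"
    using assms(1) by (subst meta_fib.simps) simp
  also have "\<dots> = (\<Sum>i\<in>(\<lambda>k. n - k) ` {1..r n}. meta_fib r i)"
    using sum.reindex[OF inj, of "meta_fib r"] by simp
  also have "\<dots> \<le> (\<Sum>i<n. meta_fib r i)"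
    using assms(1) by (intro sum_mono2) auto
  finally show ?thesis .
qed

text \<open>
  Bounding the partial sums rather than the terms keeps the induction one-step: the
  new term is at most the old partial sum, which doubles.
\<close>

lemma sum_le_power2_if_le_prefix_sum:
  fixes f :: "nat \<Rightarrow> nat"
  assumes "f 0 \<le> 1" and "\<And>n. n \<ge> 1 \<Longrightarrow> f n \<le> (\<Sum>i<n. f i)"
  shows "(\<Sum>i<Suc n. f i) \<le> 2 ^ n"
proof (induction n)
  case 0
  show ?case using assms(1) by simp
next
  case (Suc n)
  have "(\<Sum>i<Suc (Suc n). f i) = (\<Sum>i<Suc n. f i) + f (Suc n)"
    by simp
  also have "\<dots> \<le> 2 * (\<Sum>i<Suc n. f i)"
    using assms(2)[of "Suc n"] by simp
  also have "\<dots> \<le> 2 ^ Suc n"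
    using Suc.IH by simp
  finally show ?case .
qed

theorem lemma2p6:
  fixes r :: "nat \<Rightarrow> nat" and n :: nat
  assumes "meta_fib_generator r" and "n \<ge> 1"
  shows "meta_fib r n \<le> 2 ^ (n - 1)"
proof -
  have prefix: "meta_fib r m \<le> (\<Sum>i<m. meta_fib r i)" if "m \<ge> 1" for m
    using assms(1) that by (intro meta_fib_le_sum_lessThan) (auto simp: meta_fib_generator_def)
  have "meta_fib r 0 \<le> 1"
    by (simp add: meta_fib.simps)
  then have "(\<Sum>i<Suc (n - 1). meta_fib r i) \<le> 2 ^ (n - 1)"
    using prefix by (rule sum_le_power2_if_le_prefix_sum)
  with prefix[OF assms(2)] assms(2) show ?thesis
    by simp
qed

end
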